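(* There is a constant $c>0$ such that every pairwise single-meeting storyline with $n\ge 2$ characters whose event graph is a tree admits a storyline visualization with at most $c\, n\log n$ crossings; that is, such a storyline always has a storyline visualization with $O(n\log n)$ crossings.
   Context: A storyline $S=(C,\mathcal{T},\mathcal{E})$ consists of a set of characters $C=\{1,\dots,n\}$, a set $\mathcal{T}$ of closed time intervals $[s,t]$ with $s,t\in\mathbb{N}$, $s\le t$, and a set of events $\mathcal{E}\subseteq 2^C\times\mathcal{T}$; an event $E_i=(C_i,[s_i,t_i])$ means the characters in $C_i$ meet during the whole interval $[s_i,t_i]$, and no character participates in two events with overlapping time intervals. A storyline visualization is a drawing in the plane in which the $x$-axis represents time and each character is drawn as an $x$-monotone curve, so that at each time the curves appear in some vertical order; during each event $(C_i,[s_i,t_i])$ the curves of the characters in $C_i$ are grouped within a small vertical distance $\delta_{\mathrm{group}}$ of one another (in particular they are consecutive in the vertical order), while otherwise curves are separated by a larger vertical distance $\delta_{\mathrm{separate}}>\delta_{\mathrm{group}}$. The number of crossings of a visualization is the total number of crossing points between pairs of character curves. A storyline is pairwise single-meeting if every event involves exactly two characters and every pair of characters meets in at most one event. Its event graph is the graph with vertex set $C$ having an edge $\{u,v\}$ for each event $(\{u,v\},[s,t])$.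
   Formalization: The separation distance between curves not meeting is required only at natural-number times, and a curve may pass through an ongoing meeting at a point common to its curves (crossings counted); were meetings impassable, the bound would be false. *)

theory Defs
  imports Complex_Main
begin

text \<open>A closed time interval with natural end points is the pair of its end points, and an event
  is a set of characters with such an interval.\<close>

type_synonym interval = "nat \<times> nat"

type_synonym event = "nat set \<times> interval"

text \<open>As the intervals are closed, intervals that share just an end point overlap.\<close>

definition overlap :: "interval \<Rightarrow> interval \<Rightarrow> bool" where
  "overlap I J \<longleftrightarrow> {fst I..snd I} \<inter> {fst J..snd J} \<noteq> {}"

definition storyline :: "nat \<Rightarrow> interval set \<Rightarrow> event set \<Rightarrow> bool" where
  "storyline n T E \<longleftrightarrow>
     (\<forall>(s, t) \<in> T. s \<le> t) \<and>
     E \<subseteq> Pow {1..n} \<times> T \<and>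
     (\<forall>(A, I) \<in> E. \<forall>(B, J) \<in> E. (A, I) \<noteq> (B, J) \<and> overlap I J \<longrightarrow> A \<inter> B = {})"

definition pairwise_single_meeting :: "event set \<Rightarrow> bool" where
  "pairwise_single_meeting E \<longleftrightarrow>
     (\<forall>e \<in> E. card (fst e) = 2) \<and>
     (\<forall>u v. u \<noteq> v \<longrightarrow> (\<forall>e \<in> E. \<forall>e' \<in> E. {u, v} \<subseteq> fst e \<and> {u, v} \<subseteq> fst e' \<longrightarrow> e = e'))"

definition event_graph_edges :: "event set \<Rightarrow> nat set set" where
  "event_graph_edges E = {{u, v} |u v s t. ({u, v}, (s, t)) \<in> E}"

text \<open>Finite simple graphs are given by a vertex set and a set of two-element edges.\<close>

definition graph_connected :: "'a set \<Rightarrow> 'a set set \<Rightarrow> bool" where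
  "graph_connected V F \<longleftrightarrow> (\<forall>u \<in> V. \<forall>v \<in> V. (u, v) \<in> {(x, y). {x, y} \<in> F}\<^sup>*)"

definition graph_cycle :: "'a set set \<Rightarrow> 'a list \<Rightarrow> bool" where
  "graph_cycle F xs \<longleftrightarrow> length xs \<ge> 3 \<and> distinct xs \<and>
     (\<forall>i < length xs. {xs ! i, xs ! (Suc i mod length xs)} \<in> F)"

definition graph_tree :: "'a set \<Rightarrow> 'a set set \<Rightarrow> bool" where
  "graph_tree V F \<longleftrightarrow> V \<noteq> {} \<and> graph_connected V F \<and> (\<nexists>xs. graph_cycle F xs)"

text \<open>The drawing places character \<open>i\<close> at height \<open>y i x\<close> at time \<open>x \<ge> 0\<close>, so an \<open>x\<close>-monotone
  curve is the graph of the continuous function \<open>y i\<close>. Two curves have only finitely many common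
  points; hence a vertical order of the curves is defined at all but finitely many times.

  Grouping is required at every real time of an event. The order is allowed to have ties at the
  common points, so that a group is consecutive if no other curve is strictly between two of its
  members. In particular a curve may traverse a group at a point common to all members. This is
  needed for the tree bound: if no curve could traverse a group, then the tree with edges \<open>u w\<^sub>i\<close>,
  \<open>w\<^sub>i x\<^sub>i\<close>, \<open>x\<^sub>i y\<^sub>i\<close> for \<open>i = 1, \<dots>, k\<close>, where first all \<open>w\<^sub>i\<close>, \<open>x\<^sub>i\<close> meet simultaneously, then
  all \<open>x\<^sub>i\<close>, \<open>y\<^sub>i\<close> meet until the end, and meanwhile \<open>u\<close> meets \<open>w\<^sub>1, \<dots>, w\<^sub>k\<close> one by one, would force
  quadratically many crossings.

  Continuous curves cannot jump from distance \<open>d_separate\<close> to a crossing or to distance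
  \<open>d_group\<close>. The separation of characters that do not meet is therefore required at the time
  steps of the storyline, the natural numbers, and the transitions take place in between.\<close>

definition storyline_visualization ::
  "real \<Rightarrow> real \<Rightarrow> nat \<Rightarrow> event set \<Rightarrow> (nat \<Rightarrow> real \<Rightarrow> real) \<Rightarrow> bool" where
  "storyline_visualization d_group d_separate n E y \<longleftrightarrow>
     (\<forall>i \<in> {1..n}. continuous_on {0..} (y i)) \<and>
     (\<forall>i \<in> {1..n}. \<forall>j \<in> {1..n}. i \<noteq> j \<longrightarrow> finite {x. 0 \<le> x \<and> y i x = y j x}) \<and>
     (\<forall>(A, (s, t)) \<in> E. \<forall>x \<in> {real s..real t}. \<forall>i \<in> A. \<forall>j \<in> A.
        \<bar>y i x - y j x\<bar> \<le> d_group \<and>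
        (\<forall>k \<in> {1..n} - A. \<not> (y i x < y k x \<and> y k x < y j x))) \<and>
     (\<forall>m::nat. \<forall>i \<in> {1..n}. \<forall>j \<in> {1..n}. i \<noteq> j \<longrightarrow>
        (\<nexists>A s t. (A, (s, t)) \<in> E \<and> {i, j} \<subseteq> A \<and> s \<le> m \<and> m \<le> t) \<longrightarrow>
        \<bar>y i (real m) - y j (real m)\<bar> \<ge> d_separate)"

definition crosses_at :: "(real \<Rightarrow> real) \<Rightarrow> (real \<Rightarrow> real) \<Rightarrow> real \<Rightarrow> bool" where
  "crosses_at f g x \<longleftrightarrow>
     (\<forall>\<^sub>F z in at_left x. f z < g z) \<and> (\<forall>\<^sub>F z in at_right x. g z < f z) \<or>
     (\<forall>\<^sub>F z in at_left x. g z < f z) \<and> (\<forall>\<^sub>F z in at_right x. f z < g z)"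

text \<open>A point through which several curves pass counts once for each pair that crosses there. For
  the curves of a visualization the set is finite, since crossing points are common points.\<close>

definition num_crossings :: "nat \<Rightarrow> (nat \<Rightarrow> real \<Rightarrow> real) \<Rightarrow> nat" where
  "num_crossings n y =
     card {(i, j, x). i \<in> {1..n} \<and> j \<in> {1..n} \<and> i < j \<and> 0 < x \<and> crosses_at (y i) (y j) x}"

end

theory Submission
  imports Defs
begin

text \<open>Root the tree and nest the characters vertically: the stripe of a subtree consists of its root
  \<open>v\<close>, then the stripes of the light children of \<open>v\<close> in the order of their meetings with \<open>v\<close>, then
  the stripe of the heavy child (the one with the largest subtree). Only \<open>v\<close> moves inside this
  stripe, and never into the stripe of the heavy child: it stays on top while it meets its parent,
  goes directly above the heavy stripe while it meets the heavy child, and otherwise sweeps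
  through the light stripes as time passes. Every meeting is then one of vertical neighbours, and
  \<open>v\<close> crosses each of its descendants in light stripes at most five times. A character lies in at
  most \<open>log\<^sub>2 n\<close> light stripes, since leaving one at least doubles the subtree.

  A vertical order for each integer time suffices for a drawing: half way between two integer
  times all curves pass through one common point, so that two of them cross there exactly if
  their order changes.\<close>

section \<open>Drawings from heights at integer times\<close>

text \<open>The last weight stays 1 after time \<open>M\<close>, as two curves may have only finitely many common points.\<close>

definition weight :: "nat \<Rightarrow> nat \<Rightarrow> real \<Rightarrow> real" where
  "weight M m x = max 0 (if m = M then min 1 (2 * (x - real M) + 1) else 1 - 2 * \<bar>x - real m\<bar>)"

definition curve :: "nat \<Rightarrow> (nat \<Rightarrow> nat \<Rightarrow> real) \<Rightarrow> nat \<Rightarrow> real \<Rightarrow> real" where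
  "curve M h i x = (\<Sum>m\<le>M. weight M m x * h m i)"

text \<open>At time \<open>x\<close> only the weight of the nearest integer time \<open>m\<close> is nonzero.\<close>

definition near :: "nat \<Rightarrow> nat \<Rightarrow> real \<Rightarrow> bool" where
  "near M m x \<longleftrightarrow> m \<le> M \<and> real m - 1/2 \<le> x \<and> (m < M \<longrightarrow> x \<le> real m + 1/2)"

text \<open>The weights live on unit cells around the integers, the last cell being unbounded; two
  cells share at most an end point, where both weights vanish.\<close>

lemma weight_eq_0:
  assumes "near M m x" "k \<le> M" "k \<noteq> m"
  shows "weight M k x = 0"
proof (cases "k < m")
  case True
  then have "real k + 1 \<le> real m" by linarith
  moreover have "k \<noteq> M" using True assms(1) by (auto simp: near_def)
  ultimately show ?thesis using assms by (auto simp: weight_def near_def)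
next
  case False
  then have km: "m < k" using assms(3) by simp
  then have "real m + 1 \<le> real k" by linarith
  moreover have "x \<le> real m + 1/2" using km assms by (auto simp: near_def)
  ultimately show ?thesis using assms by (auto simp: weight_def near_def)
qed

text \<open>Within one cell all curves are scaled by the same factor in \<open>[0, 1]\<close>:
  distances never grow, and where the factor is positive the order is that of
  \<open>h m\<close>.\<close>

lemma curve_near:
  assumes "near M m x"
  shows "curve M h i x = weight M m x * h m i"
proof -
  have "curve M h i x = (\<Sum>k\<in>{m}. weight M k x * h k i)"
    unfolding curve_def using assms
    by (intro sum.mono_neutral_right) (auto simp: near_def dest: weight_eq_0[OF assms])
  then show ?thesis by simp
qed

text \<open>The two bounds keep \<open>m\<close> inside every event interval that contains
  \<open>x\<close>, which reduces grouping at real times to integer times.\<close>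

lemma near_exists:
  assumes "0 \<le> x"
  shows "\<exists>m. near M m x \<and> (\<forall>s \<le> M. real s \<le> x \<longrightarrow> s \<le> m) \<and> (\<forall>t::nat. x \<le> real t \<longrightarrow> m \<le> t)"
proof -
  define q where "q = nat \<lfloor>x + 1/2\<rfloor>"
  have q: "real q \<le> x + 1/2" "x + 1/2 < real q + 1"
    unfolding q_def using assms by linarith+
  show ?thesis
  proof (intro exI[of _ "min M q"] conjI allI impI)
    show "near M (min M q) x"
      using q unfolding near_def by (auto simp: min_def)
    show "s \<le> min M q" if "s \<le> M" "real s \<le> x" for s
    proof -
      have "real s < real q + 1" using that q by linarith
      then show ?thesis using that by simp
    qed
    show "min M q \<le> t" if "x \<le> real t" for t
    proof -
      have "real q < real t + 1" using that q by linarith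
      then show ?thesis by simp
    qed
  qed
qed

lemma weight_nonneg: "0 \<le> weight M m x"
  by (simp add: weight_def)

lemma weight_le_1: "weight M m x \<le> 1"
  by (simp add: weight_def)

lemma weight_pos:
  assumes "near M m x" "x \<noteq> real m - 1/2" "m < M \<Longrightarrow> x \<noteq> real m + 1/2"
  shows "0 < weight M m x"
  using assms by (auto simp: weight_def near_def max_def min_def abs_if)

lemma weight_zeroD:
  assumes "near M m x" "weight M m x = 0" "0 \<le> x"
  shows "\<exists>q<M. x = real q + 1/2"
proof -
  consider "x = real m - 1/2" | "m < M" "x = real m + 1/2"
    using weight_pos[OF assms(1)] assms(2) by fastforce
  then show ?thesis
  proof cases
    case 1
    with assms have "m \<noteq> 0" "m \<le> M" by (auto simp: near_def intro!: gr0I)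
    then have "m - 1 < M" "real (m - 1) = real m - 1" by auto
    with 1 show ?thesis by (intro exI[of _ "m - 1"]) auto
  qed auto
qed

lemma near_nat:
  assumes "p \<le> M"
  shows "near M p (real p)" "weight M p (real p) = 1"
  using assms by (auto simp: near_def weight_def)

lemma near_last:
  assumes "M \<le> p"
  shows "near M M (real p)" "weight M M (real p) = 1"
  using assms by (auto simp: near_def weight_def)

lemma continuous_on_curve: "continuous_on S (curve M h i)"
proof -
  have "continuous_on S (\<lambda>x. weight M m x)" for m
    unfolding weight_def by (cases "m = M") (auto intro!: continuous_intros)
  then show ?thesis
    unfolding curve_def by (intro continuous_intros)
qed

text \<open>A strict inequality of continuous functions at \<open>x\<close> persists on both sides,
  whereas a crossing has opposite strict orders there.\<close>

lemma crosses_at_eq: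
  fixes f g :: "real \<Rightarrow> real"
  assumes "isCont f x" "isCont g x" "crosses_at f g x"
  shows "f x = g x"
proof (rule ccontr)
  assume ne: "f x \<noteq> g x"
  have no: False if "isCont f x" "isCont g x" "f x < g x"
    "\<not> (\<exists>\<^sub>F z in at_left x. f z < g z) \<or> \<not> (\<exists>\<^sub>F z in at_right x. f z < g z)" for f g :: "real \<Rightarrow> real"
  proof -
    have "((\<lambda>z. g z - f z) \<longlongrightarrow> g x - f x) (at x)"
      using that by (intro tendsto_diff) (auto simp: isCont_def)
    then have "\<forall>\<^sub>F z in at x. 0 < g z - f z"
      by (rule order_tendstoD) (use that in simp)
    then have "\<forall>\<^sub>F z in at_left x. f z < g z" "\<forall>\<^sub>F z in at_right x. f z < g z"
      by (auto simp: eventually_at_split)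
    with that(4) show False
      by (metis eventually_frequently trivial_limit_at_left_real trivial_limit_at_right_real)
  qed
  have E: "\<not> (\<exists>\<^sub>F z in F. g z < f z)" if "\<forall>\<^sub>F z in F. f z < g z" for f g :: "real \<Rightarrow> real" and F
    using that unfolding frequently_def by (auto elim: eventually_mono)
  show False
  proof (cases "f x < g x")
    case True
    show False
      by (rule no[OF assms(1,2) True]) (use assms(3) E in \<open>auto simp: crosses_at_def\<close>)
  next
    case False
    then have "g x < f x" using ne by simp
    show False
      by (rule no[OF assms(2,1) \<open>g x < f x\<close>]) (use assms(3) E in \<open>auto simp: crosses_at_def\<close>)
  qed
qed

text \<open>Just before \<open>q + 1/2\<close> both curves are the same positive multiple of their
  heights at time \<open>q\<close>; just after, the same holds with \<open>Suc q\<close>.\<close>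

lemma curve_order_left:
  assumes "q < M" "\<forall>\<^sub>F z in at_left (real q + 1/2). curve M h i z < curve M h j z"
  shows "h q i < h q j"
proof -
  have "\<forall>\<^sub>F z in at_left (real q + 1/2). real q < z \<and> z < real q + 1/2"
    by (intro eventually_at_leftI[of "real q"]) auto
  with assms(2) have "\<forall>\<^sub>F z in at_left (real q + 1/2). h q i < h q j"
  proof eventually_elim
    case (elim z)
    then have nz: "near M q z" "0 < weight M q z"
      using assms(1) by (auto simp: near_def intro!: weight_pos)
    then show ?case using elim by (simp add: curve_near)
  qed
  then show ?thesis by (simp add: trivial_limit_at_left_real)
qed

lemma curve_order_right:
  assumes "q < M" "\<forall>\<^sub>F z in at_right (real q + 1/2). curve M h i z < curve M h j z"
  shows "h (Suc q) i < h (Suc q) j"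
proof -
  have "\<forall>\<^sub>F z in at_right (real q + 1/2). real q + 1/2 < z \<and> z < real (Suc q)"
    by (intro eventually_at_rightI[of _ "real (Suc q)"]) auto
  with assms(2) have "\<forall>\<^sub>F z in at_right (real q + 1/2). h (Suc q) i < h (Suc q) j"
  proof eventually_elim
    case (elim z)
    then have nz: "near M (Suc q) z" "0 < weight M (Suc q) z"
      using assms(1) by (auto simp: near_def intro!: weight_pos)
    then show ?case using elim by (simp add: curve_near)
  qed
  then show ?thesis by (simp add: trivial_limit_at_right_real)
qed

lemma storyline_disjoint:
  assumes "storyline n T E" "e \<in> E" "e' \<in> E" "e \<noteq> e'" "overlap (snd e) (snd e')"
  shows "fst e \<inter> fst e' = {}"
proof -
  have "\<forall>e \<in> E. \<forall>e' \<in> E. e \<noteq> e' \<and> overlap (snd e) (snd e') \<longrightarrow> fst e \<inter> fst e' = {}"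
    using assms(1) unfolding storyline_def case_prod_beta prod.collapse by (elim conjE) assumption
  then show ?thesis using assms(2-) by blast
qed

lemma storyline_overlap_eq:
  assumes "storyline n T E" "(A, (s, t)) \<in> E" "(B, (s', t')) \<in> E" "a \<in> A" "a \<in> B"
    and "s \<le> m" "m \<le> t" "s' \<le> m" "m \<le> t'"
  shows "A = B \<and> s = s' \<and> t = t'"
proof (rule ccontr)
  assume "\<not> ?thesis"
  then have "(A, (s, t)) \<noteq> (B, (s', t'))" by blast
  moreover have "m \<in> {s..t} \<inter> {s'..t'}" using assms(6-9) by simp
  then have "overlap (s, t) (s', t')" unfolding overlap_def fst_conv snd_conv by blast
  ultimately have "A \<inter> B = {}"
    using storyline_disjoint[OF assms(1-3)] by simp
  then show False using assms(4,5) by blast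
qed

text \<open>The witness is \<open>curve M h\<close>. Grouping survives as the factors are at most 1,
  separation is asked for only at integers, where the factor is 1, and two curves meet only at times
  \<open>q + 1/2\<close> with \<open>q < M\<close>.\<close>

lemma visualization_from_heights:
  fixes h :: "nat \<Rightarrow> nat \<Rightarrow> real"
  assumes g: "0 < g" "g < D"
    and st: "storyline n T E"
    and M: "\<And>A s t. (A, (s, t)) \<in> E \<Longrightarrow> t < M"
    and inj: "\<And>m. m \<le> M \<Longrightarrow> inj_on (h m) {1..n}"
    and close: "\<And>m A s t i j. (A, (s, t)) \<in> E \<Longrightarrow> s \<le> m \<Longrightarrow> m \<le> t \<Longrightarrow> i \<in> A \<Longrightarrow> j \<in> A \<Longrightarrow>
        \<bar>h m i - h m j\<bar> \<le> g"
    and far: "\<And>m i j. m \<le> M \<Longrightarrow> i \<in> {1..n} \<Longrightarrow> j \<in> {1..n} \<Longrightarrow> i \<noteq> j \<Longrightarrow>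
        \<nexists>A s t. (A, (s, t)) \<in> E \<and> {i, j} \<subseteq> A \<and> s \<le> m \<and> m \<le> t \<Longrightarrow> D \<le> \<bar>h m i - h m j\<bar>"
  shows "\<exists>y. storyline_visualization g D n E y \<and>
    num_crossings n y \<le> card {(i, j, m). i \<in> {1..n} \<and> j \<in> {1..n} \<and> i < j \<and> m < M \<and>
      (h m i < h m j) \<noteq> (h (Suc m) i < h (Suc m) j)}"
proof -
  let ?y = "curve M h"
  have common: "\<exists>q<M. x = real q + 1/2"
    if ij: "i \<in> {1..n}" "j \<in> {1..n}" "i \<noteq> j" "0 \<le> x" "?y i x = ?y j x" for i j x
  proof -
    obtain m where m: "near M m x" using near_exists[OF ij(4)] by blast
    have "h m i \<noteq> h m j"
      using inj_onD[OF inj, of m i j] m ij(1-3) unfolding near_def by blast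
    then have "weight M m x = 0" using ij(5) by (simp add: curve_near[OF m])
    then show ?thesis using weight_zeroD m ij(4) by blast
  qed
  have vis: "storyline_visualization g D n E ?y"
    unfolding storyline_visualization_def
  proof (intro conjI ballI impI allI)
    show "continuous_on {0..} (?y i)" for i by (rule continuous_on_curve)
  next
    fix i j assume ij: "i \<in> {1..n}" "j \<in> {1..n}" "i \<noteq> j"
    have "{x. 0 \<le> x \<and> ?y i x = ?y j x} \<subseteq> (\<lambda>q. real q + 1/2) ` {..<M}"
      using common[OF ij] by auto
    then show "finite {x. 0 \<le> x \<and> ?y i x = ?y j x}" by (rule finite_subset) auto
  next
    fix e assume e: "e \<in> E"
    obtain A s t where e_eq: "e = (A, (s, t))" by (cases e) auto
    have A: "(A, (s, t)) \<in> E" "A \<subseteq> {1..n}"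
      using e e_eq st by (auto simp: storyline_def)
    have *: "\<bar>?y i x - ?y j x\<bar> \<le> g \<and> (\<forall>k \<in> {1..n} - A. \<not> (?y i x < ?y k x \<and> ?y k x < ?y j x))"
      if x: "x \<in> {real s..real t}" and ij: "i \<in> A" "j \<in> A" for x i j
    proof -
      have "0 \<le> x" using x by (auto intro: order_trans[of 0 "real s"])
      then obtain m where m: "near M m x" "\<And>s::nat. s \<le> M \<Longrightarrow> real s \<le> x \<Longrightarrow> s \<le> m"
        "\<And>t::nat. x \<le> real t \<Longrightarrow> m \<le> t" using near_exists by blast
      have "s \<le> t" using st A unfolding storyline_def by fast
      then have mst: "s \<le> m" "m \<le> t" using m(2)[of s] m(3)[of t] x M[OF A(1)] by auto
      have mM: "m \<le> M" using mst M[OF A(1)] by simp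
      let ?w = "weight M m x"
      have hg: "\<bar>h m i - h m j\<bar> \<le> g" using close[OF A(1) mst ij] .
      have "\<bar>?y i x - ?y j x\<bar> = ?w * \<bar>h m i - h m j\<bar>"
        by (simp add: curve_near[OF m(1)] right_diff_distrib[symmetric] abs_mult weight_nonneg)
      also have "\<dots> \<le> 1 * g"
        using hg g by (intro mult_mono) (auto simp: weight_nonneg weight_le_1)
      finally have 1: "\<bar>?y i x - ?y j x\<bar> \<le> g" by simp
      have "\<not> (?y i x < ?y k x \<and> ?y k x < ?y j x)" if k: "k \<in> {1..n} - A" for k
      proof
        assume "?y i x < ?y k x \<and> ?y k x < ?y j x"
        then have "?w * h m i < ?w * h m k" "?w * h m k < ?w * h m j"
          by (auto simp: curve_near[OF m(1)])
        then have "h m i < h m k" "h m k < h m j"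
          using weight_nonneg[of M m x] by (auto simp: mult_less_cancel_left)
        \<comment> \<open>As \<open>i\<close> attends no second event at time \<open>m\<close>,
          \<open>k\<close> is farther than \<open>g\<close> from \<open>i\<close> and has no room
          between \<open>i\<close> and \<open>j\<close>.\<close>
        moreover have "D \<le> \<bar>h m i - h m k\<bar>"
        proof (rule far[OF mM])
          show "i \<in> {1..n}" "k \<in> {1..n}" "i \<noteq> k" using ij k A by auto
          show "\<nexists>A s t. (A, (s, t)) \<in> E \<and> {i, k} \<subseteq> A \<and> s \<le> m \<and> m \<le> t"
          proof
            assume "\<exists>A s t. (A, (s, t)) \<in> E \<and> {i, k} \<subseteq> A \<and> s \<le> m \<and> m \<le> t"
            then obtain B s' t' where B: "(B, (s', t')) \<in> E" "{i, k} \<subseteq> B" "s' \<le> m" "m \<le> t'" by blast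
            then have "A = B" using storyline_overlap_eq[OF st A(1) B(1), of i m] ij mst by auto
            then show False using B k by auto
          qed
        qed
        ultimately show False using hg g by linarith
      qed
      with 1 show ?thesis by blast
    qed
    show "case e of (A, s, t) \<Rightarrow> \<forall>x\<in>{real s..real t}. \<forall>i\<in>A. \<forall>j\<in>A.
        \<bar>?y i x - ?y j x\<bar> \<le> g \<and> (\<forall>k\<in>{1..n} - A. \<not> (?y i x < ?y k x \<and> ?y k x < ?y j x))"
      unfolding e_eq using * by simp
  next
    fix p i j assume ij: "i \<in> {1..n}" "j \<in> {1..n}" "i \<noteq> j"
      and no: "\<nexists>A s t. (A, (s, t)) \<in> E \<and> {i, j} \<subseteq> A \<and> s \<le> p \<and> p \<le> t"
    show "D \<le> \<bar>?y i (real p) - ?y j (real p)\<bar>"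
    proof (cases "p \<le> M")
      case True
      then show ?thesis using far[OF True ij no] by (simp add: curve_near[OF near_nat(1)] near_nat)
    next
      case False
      then have "M \<le> p" by simp
      \<comment> \<open>Every event ends before \<open>M\<close>, so nobody meets at time
        \<open>M\<close>, whose heights are kept from then on.\<close>
      moreover have "D \<le> \<bar>h M i - h M j\<bar>"
        by (rule far[OF order_refl ij]) (use M in force)
      ultimately show ?thesis by (simp add: curve_near[OF near_last(1)] near_last)
    qed
  qed
  let ?S = "{(i, j, m). i \<in> {1..n} \<and> j \<in> {1..n} \<and> i < j \<and> m < M \<and>
      (h m i < h m j) \<noteq> (h (Suc m) i < h (Suc m) j)}"
  let ?f = "\<lambda>(i, j, m). (i, j, real m + 1/2)"
  have "?S \<subseteq> {1..n} \<times> {1..n} \<times> {..<M}" by auto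
  then have fin: "finite ?S" by (rule finite_subset) auto
  have "{(i, j, x). i \<in> {1..n} \<and> j \<in> {1..n} \<and> i < j \<and> 0 < x \<and> crosses_at (?y i) (?y j) x} \<subseteq> ?f ` ?S"
  proof safe
    fix i j x assume ij: "i \<in> {1..n}" "j \<in> {1..n}" "i < j" "0 < x" "crosses_at (?y i) (?y j) x"
    have c: "isCont (?y i) x" for i
      using continuous_on_curve[of UNIV] by (simp add: continuous_on_eq_continuous_at)
    have "?y i x = ?y j x" by (rule crosses_at_eq[OF c c ij(5)])
    then obtain q where q: "q < M" "x = real q + 1/2" using common[of i j x] ij by auto
    have "(h q i < h q j) \<noteq> (h (Suc q) i < h (Suc q) j)"
      using ij(5) curve_order_left[OF q(1)] curve_order_right[OF q(1)]
      unfolding crosses_at_def q(2) by (meson less_asym)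
    then have "(i, j, q) \<in> ?S" using ij q by auto
    then show "(i, j, x) \<in> ?f ` ?S" using q by (force simp: image_iff)
  qed
  then have "num_crossings n ?y \<le> card (?f ` ?S)"
    unfolding num_crossings_def using fin by (intro card_mono finite_imageI)
  also have "\<dots> \<le> card ?S" by (rule card_image_le[OF fin])
  finally show ?thesis using vis by blast
qed

section \<open>Rooted trees and light children\<close>

text \<open>The root is its own parent; the depth ensures that iterating \<open>par\<close> from any
  vertex of \<open>V\<close> ends in \<open>r\<close>.\<close>

locale rooted_tree =
  fixes V :: "nat set" and r :: nat and par :: "nat \<Rightarrow> nat" and dep :: "nat \<Rightarrow> nat"
  assumes finite_V: "finite V"
    and root_in: "r \<in> V"
    and par_root: "par r = r"
    and dep_root: "dep r = 0"
    and par_in: "v \<in> V \<Longrightarrow> par v \<in> V"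
    and dep_par: "v \<in> V - {r} \<Longrightarrow> dep v = Suc (dep (par v))"
begin

section \<open>Ancestors and the relative position of two vertices\<close>

inductive anc :: "nat \<Rightarrow> nat \<Rightarrow> bool" where
  anc_refl: "anc v v"
| anc_step: "anc a (par v) \<Longrightarrow> anc a v"

lemma anc_par: "anc a v \<Longrightarrow> anc (par a) v"
  by (induction rule: anc.induct) (auto intro: anc.intros)

lemma anc_iff: "anc a v \<longleftrightarrow> a = v \<or> anc a (par v)"
  by (auto intro: anc.intros elim: anc.cases)

lemma dep_par_le: "v \<in> V \<Longrightarrow> dep (par v) \<le> dep v"
  using dep_par[of v] par_root by (cases "v = r") auto

lemma anc_dep: "anc a v \<Longrightarrow> v \<in> V \<Longrightarrow> dep a \<le> dep v"
  by (induction rule: anc.induct) (auto intro: par_in order_trans[OF _ dep_par_le])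

lemma anc_rootD: "anc a v \<Longrightarrow> v = r \<Longrightarrow> a = r"
  by (induction rule: anc.induct) (auto simp: par_root)

lemma dep_0_iff: "v \<in> V \<Longrightarrow> dep v = 0 \<longleftrightarrow> v = r"
  using dep_par[of v] dep_root by (cases "v = r") auto

lemma tree_induct [consumes 1, case_names root child]:
  assumes "v \<in> V"
    and "P r"
    and "\<And>v. v \<in> V - {r} \<Longrightarrow> P (par v) \<Longrightarrow> P v"
  shows "P v"
  using assms(1)
proof (induction "dep v" arbitrary: v)
  case 0
  then show ?case using dep_0_iff[of v] assms(2) by simp
next
  case (Suc k)
  then have "v \<in> V - {r}" using dep_root by auto
  then show ?case using Suc dep_par[of v] par_in assms(3) by auto
qed

lemma anc_same_dep: "anc a v \<Longrightarrow> v \<in> V \<Longrightarrow> dep a = dep v \<Longrightarrow> a = v"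
proof (induction rule: anc.induct)
  case (anc_step a v)
  show ?case
  proof (cases "v = r")
    case True
    then show ?thesis using anc_step anc_rootD par_root by auto
  next
    case False
    then have "dep v = Suc (dep (par v))" using dep_par anc_step by auto
    then show ?thesis using anc_dep[OF anc_step(1)] par_in anc_step by auto
  qed
qed simp

lemma anc_comparable:
  assumes "anc a v" "anc b v" "v \<in> V" "dep a \<le> dep b"
  shows "anc a b"
  using assms(1,3,4,2)
proof (induction rule: anc.induct)
  case (anc_refl v)
  then show ?case using anc_same_dep[of b v] anc_dep[of b v] by (auto intro: anc.intros)
next
  case (anc_step a v)
  then show ?case using par_in anc_iff[of b v] by (auto intro: anc.anc_step)
qed

definition siblings :: "nat \<Rightarrow> nat \<Rightarrow> bool" where
  "siblings c d \<longleftrightarrow> c \<in> V - {r} \<and> d \<in> V - {r} \<and> c \<noteq> d \<and> par c = par d"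

lemma siblings_sym: "siblings c d \<Longrightarrow> siblings d c"
  by (auto simp: siblings_def)

text \<open>The induction replaces the deeper vertex by its parent, and both vertices once their
  depths agree. Positions will be compared at \<open>c\<close>, or at \<open>c\<close> and
  \<open>d\<close>.\<close>

lemma positions_shallow:
  assumes "i \<in> V" "j \<in> V" "i \<noteq> j" "dep i \<le> dep j"
  shows "(\<exists>c \<in> V - {r}. par c = i \<and> anc c j) \<or> (\<exists>c d. siblings c d \<and> anc c i \<and> anc d j)"
  using assms(2,1,3,4)
proof (induction j arbitrary: i rule: tree_induct)
  case root
  then show ?case using dep_0_iff[of i] dep_root by auto
next
  case (child j)
  have dj: "dep j = Suc (dep (par j))" using child dep_par by blast
  show ?case
  proof (cases "dep i \<le> dep (par j)")
    case True
    show ?thesis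
    proof (cases "i = par j")
      case True
      then show ?thesis using child anc_refl by blast
    next
      case False
      then show ?thesis using child.IH[of i] child.prems True by (meson anc_step)
    qed
  next
    case False
    then have di: "dep i = dep j" using dj child.prems by simp
    then have i: "i \<in> V - {r}" using dj child.prems dep_root by auto
    then have dpi: "dep (par i) = dep (par j)" using dj di dep_par by simp
    show ?thesis
    proof (cases "par i = par j")
      case True
      then have "siblings i j" using i child by (auto simp: siblings_def)
      then show ?thesis using anc_refl by blast
    next
      case False
      \<comment> \<open>The two parents have equal depth and a child of \<open>par i\<close> is
        deeper, so only the alternative with siblings remains.\<close>
      have "\<nexists>c. c \<in> V - {r} \<and> par c = par i \<and> anc c (par j)"
      proof
        assume "\<exists>c. c \<in> V - {r} \<and> par c = par i \<and> anc c (par j)"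
        then obtain c where c: "c \<in> V - {r}" "par c = par i" "anc c (par j)" by blast
        have "dep c = Suc (dep (par i))" using c dep_par by metis
        moreover have "dep c \<le> dep (par j)" using anc_dep[OF c(3)] par_in child by blast
        ultimately show False using dpi by simp
      qed
      then have "\<exists>c d. siblings c d \<and> anc c (par i) \<and> anc d (par j)"
        using child.IH[of "par i"] par_in i False dpi by auto
      then show ?thesis by (meson anc_step)
    qed
  qed
qed

lemma positions_cases:
  assumes "i \<in> V" "j \<in> V" "i \<noteq> j"
  obtains (above) c where "c \<in> V - {r}" "par c = i" "anc c j"
  | (below) c where "c \<in> V - {r}" "par c = j" "anc c i"
  | (apart) c d where "siblings c d" "anc c i" "anc d j"
proof (cases "dep i \<le> dep j")
  case True
  then show thesis using positions_shallow[OF assms True] above apart by blast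
next
  case False
  then have "dep j \<le> dep i" by simp
  then show thesis using positions_shallow[OF assms(2,1)] assms(3) below apart siblings_sym by metis
qed

section \<open>Heavy and light children\<close>

definition subtree :: "nat \<Rightarrow> nat set" where
  "subtree v = {w \<in> V. anc v w}"

text \<open>For a leaf the choice is arbitrary, which is why \<open>meets_heavy\<close> tests again
  that the chosen vertex is a child.\<close>

definition heavy_child :: "nat \<Rightarrow> nat" where
  "heavy_child v = (SOME h. h \<in> V - {r} \<and> par h = v \<and>
     (\<forall>c \<in> V - {r}. par c = v \<longrightarrow> card (subtree c) \<le> card (subtree h)))"

definition light :: "nat \<Rightarrow> bool" where
  "light c \<longleftrightarrow> c \<in> V - {r} \<and> c \<noteq> heavy_child (par c)"

definition light_above :: "nat \<Rightarrow> nat set" where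
  "light_above v = {c. light c \<and> anc c v}"

lemma heavy_child:
  assumes "c \<in> V - {r}"
  defines "h \<equiv> heavy_child (par c)"
  shows "h \<in> V - {r}" "par h = par c" "card (subtree c) \<le> card (subtree h)"
proof -
  let ?C = "{c' \<in> V - {r}. par c' = par c}"
  have "finite ?C" "?C \<noteq> {}" using finite_V assms(1) by auto
  then obtain h' where h': "h' \<in> ?C" "(MAX c' \<in> ?C. card (subtree c')) = card (subtree h')"
    by (rule obtains_MAX)
  have "card (subtree c') \<le> card (subtree h')" if "c' \<in> ?C" for c'
    unfolding h'(2)[symmetric] using that \<open>finite ?C\<close> by (intro Max_ge) auto
  with h'(1) have "\<exists>h. h \<in> V - {r} \<and> par h = par c \<and>
      (\<forall>c' \<in> V - {r}. par c' = par c \<longrightarrow> card (subtree c') \<le> card (subtree h))"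
    by (intro exI[of _ h']) auto
  from someI_ex[OF this, folded heavy_child_def, folded h_def] assms(1)
  show "h \<in> V - {r}" "par h = par c" "card (subtree c) \<le> card (subtree h)" by auto
qed

lemma finite_subtree: "finite (subtree v)"
  using finite_V by (simp add: subtree_def)

lemma subtree_par: "subtree v \<subseteq> subtree (par v)"
  by (auto simp: subtree_def anc_par)

lemma siblings_subtree_disjoint:
  assumes "siblings c d"
  shows "subtree c \<inter> subtree d = {}"
proof (rule ccontr)
  assume "subtree c \<inter> subtree d \<noteq> {}"
  then obtain w where w: "w \<in> V" "anc c w" "anc d w" by (auto simp: subtree_def)
  have "dep c = dep d" using assms dep_par unfolding siblings_def by metis
  then have "anc c d" using anc_comparable[OF w(2,3,1)] by simp
  then have "c = d" using anc_same_dep \<open>dep c = dep d\<close> assms by (auto simp: siblings_def)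
  then show False using assms by (simp add: siblings_def)
qed

text \<open>The subtree of the heavy sibling is disjoint from that of \<open>c\<close> and at least
  as large.\<close>

lemma light_subtree_card:
  assumes "light c"
  shows "2 * card (subtree c) \<le> card (subtree (par c))"
proof -
  have c: "c \<in> V - {r}" using assms by (simp add: light_def)
  let ?h = "heavy_child (par c)"
  note h = heavy_child[OF c]
  have "siblings c ?h" using assms h c by (auto simp: siblings_def light_def)
  then have "card (subtree c) + card (subtree ?h) = card (subtree c \<union> subtree ?h)"
    using siblings_subtree_disjoint finite_subtree by (simp add: card_Un_disjoint)
  also have "\<dots> \<le> card (subtree (par c))"
    using subtree_par[of c] subtree_par[of ?h] h(2) finite_subtree by (intro card_mono) auto
  finally show ?thesis using h(3) by simp
qed

lemma light_above_root: "light_above r = {}"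
  by (auto simp: light_above_def light_def dest: anc_rootD)

lemma light_above_step:
  assumes "v \<in> V - {r}"
  shows "light_above v = (if light v then {v} else {}) \<union> light_above (par v)"
  using anc_iff[of _ v] by (auto simp: light_above_def)

lemma finite_light_above: "finite (light_above v)"
  using finite_V by (auto simp: light_above_def light_def intro: finite_subset[of _ V])

lemma not_anc_par: "v \<in> V - {r} \<Longrightarrow> \<not> anc v (par v)"
  using anc_dep[of v "par v"] dep_par[of v] par_in by auto

text \<open>Descending along a light edge doubles the power and at least halves the subtree; along a
  heavy edge the power stays and the subtree does not grow.\<close>

lemma light_above_card_pow:
  assumes "v \<in> V"
  shows "2 ^ card (light_above v) * card (subtree v) \<le> card V"
  using assms
proof (induction v rule: tree_induct)
  case root
  have "card (subtree r) \<le> card V" using finite_V by (intro card_mono) (auto simp: subtree_def)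
  then show ?case by (simp add: light_above_root)
next
  case (child v)
  show ?case
  proof (cases "light v")
    case True
    then have "card (light_above v) = Suc (card (light_above (par v)))"
      using child not_anc_par[of v] finite_light_above
      by (simp add: light_above_step) (simp add: light_above_def)
    then have "2 ^ card (light_above v) * card (subtree v)
        = 2 ^ card (light_above (par v)) * (2 * card (subtree v))" by simp
    also have "\<dots> \<le> 2 ^ card (light_above (par v)) * card (subtree (par v))"
      using light_subtree_card[OF True] by (intro mult_left_mono) auto
    finally show ?thesis using child.IH by simp
  next
    case False
    then have "2 ^ card (light_above v) * card (subtree v)
        = 2 ^ card (light_above (par v)) * card (subtree v)"
      using child by (simp add: light_above_step)
    also have "\<dots> \<le> 2 ^ card (light_above (par v)) * card (subtree (par v))"
      using card_mono[OF finite_subtree subtree_par[of v]] by (intro mult_left_mono) auto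
    finally show ?thesis using child.IH by simp
  qed
qed

lemma light_above_card:
  assumes "v \<in> V"
  shows "real (card (light_above v)) \<le> log 2 (real (card V))"
proof -
  have "v \<in> subtree v" using assms anc_refl by (simp add: subtree_def)
  then have "1 \<le> card (subtree v)"
    using finite_subtree by (metis One_nat_def Suc_leI card_gt_0_iff empty_iff)
  then have "2 ^ card (light_above v) * 1 \<le> 2 ^ card (light_above v) * card (subtree v)"
    by (intro mult_left_mono) auto
  then have "2 ^ card (light_above v) \<le> card V"
    using light_above_card_pow[OF assms] by linarith
  then show ?thesis
    by (rule le_log2_of_power)
qed

end

section \<open>Positions of the characters\<close>

text \<open>\<open>s v\<close> and \<open>t v\<close> delimit the meeting of \<open>v\<close> with
  its parent. The last two assumptions concern meetings that share the member
  \<open>par c\<close>.\<close>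

locale tree_schedule = rooted_tree +
  fixes s t :: "nat \<Rightarrow> nat" and M :: nat
  assumes t_less: "v \<in> V - {r} \<Longrightarrow> t v < M"
    and s_le_t: "v \<in> V - {r} \<Longrightarrow> s v \<le> t v"
    and siblings_apart: "siblings c d \<Longrightarrow> t c < s d \<or> t d < s c"
    and par_apart: "c \<in> V - {r} \<Longrightarrow> par c \<in> V - {r} \<Longrightarrow> t c < s (par c) \<or> t (par c) < s c"
begin

definition meets :: "nat \<Rightarrow> nat \<Rightarrow> bool" where
  "meets c m \<longleftrightarrow> c \<in> V - {r} \<and> s c \<le> m \<and> m \<le> t c"

definition meets_heavy :: "nat \<Rightarrow> nat \<Rightarrow> bool" where
  "meets_heavy v m \<longleftrightarrow> par (heavy_child v) = v \<and> meets (heavy_child v) m"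

text \<open>Positions are read in base \<open>2 * M + 4\<close>: the digits of \<open>v\<close> are the slots of its ancestors,
  followed by its own place among the stripes of its children. Slots are odd and own places are
  even, so that they never coincide.\<close>

definition slot :: "nat \<Rightarrow> nat" where
  "slot c = (if light c then 2 * t c + 1 else 2 * M + 3)"

text \<open>Light slots are at most \<open>2 * M - 1\<close>, so \<open>2 * M + 2\<close> lies after
  all of them and just before the heavy slot \<open>2 * M + 3\<close>. The value
  \<open>2 * m\<close> has passed exactly the light slots of meetings that ended before
  \<open>m\<close>.\<close>

definition own :: "nat \<Rightarrow> nat \<Rightarrow> nat" where
  "own v m = (if meets v m then 0 else if meets_heavy v m then 2 * M + 2 else 2 * m)"

text \<open>The place value at depth \<open>k\<close>. It is 1 one level below the deepest vertices,
  where their own digit stands.\<close>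

definition width :: "nat \<Rightarrow> nat" where
  "width k = (2 * M + 4) ^ (Suc (Max (dep ` V)) - k)"

text \<open>The stripe of \<open>v\<close> consists of the \<open>width (dep v)\<close> positions
  from \<open>base v\<close> on. The root contributes no digit.\<close>

definition base :: "nat \<Rightarrow> nat" where
  "base v = (\<Sum>a \<in> {a \<in> V - {r}. anc a v}. slot a * width (dep a))"

definition pos :: "nat \<Rightarrow> nat \<Rightarrow> nat" where
  "pos m v = base v + own v m * width (Suc (dep v))"

lemma not_meets_par: "meets c m \<Longrightarrow> \<not> meets (par c) m"
  using par_apart[of c] by (auto simp: meets_def)

lemma siblings_not_meet: "siblings c d \<Longrightarrow> meets c m \<Longrightarrow> \<not> meets d m"
  using siblings_apart[of c d] by (auto simp: meets_def)

lemma meets_heavy_iff: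
  assumes "meets c m"
  shows "meets_heavy (par c) m \<longleftrightarrow> \<not> light c"
proof
  have c: "c \<in> V - {r}" using assms by (simp add: meets_def)
  show "meets_heavy (par c) m" if "\<not> light c"
    using that c assms by (simp add: meets_heavy_def light_def)
  show "\<not> light c" if "meets_heavy (par c) m"
  proof
    assume "light c"
    then have "siblings c (heavy_child (par c))"
      using c heavy_child[OF c] by (auto simp: siblings_def light_def)
    then show False using siblings_not_meet[OF _ assms] that by (auto simp: meets_heavy_def)
  qed
qed

lemma own_par:
  assumes "meets c m"
  shows "own (par c) m = (if light c then 2 * m else 2 * M + 2)"
  using assms not_meets_par meets_heavy_iff by (auto simp: own_def)

lemma own_less: "m \<le> M \<Longrightarrow> own v m \<le> 2 * M + 2"
  by (simp add: own_def)

lemma own_neq_slot: "own v m \<noteq> slot c"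
proof -
  have "even (own v m)" "odd (slot c)" by (auto simp: own_def slot_def)
  then show ?thesis by metis
qed

lemma slot_le: "c \<in> V - {r} \<Longrightarrow> slot c \<le> 2 * M + 3"
  using t_less[of c] by (simp add: slot_def)

text \<open>At most one sibling is heavy, and the meetings of light siblings, being disjoint in
  time, end at different times.\<close>

lemma slot_siblings: "siblings c d \<Longrightarrow> slot c \<noteq> slot d"
  using siblings_apart[of c d] s_le_t[of c] s_le_t[of d] t_less[of c] t_less[of d]
  by (auto simp: slot_def siblings_def light_def)

section \<open>Nested stripes and the comparison of positions\<close>

lemma width_pos: "0 < width k"
  by (simp add: width_def)

lemma width_Suc:
  assumes "v \<in> V"
  shows "width (dep v) = (2 * M + 4) * width (Suc (dep v))"
proof -
  have "dep v \<le> Max (dep ` V)" using assms finite_V by simp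
  then show ?thesis by (simp add: width_def Suc_diff_le)
qed

lemma width_par:
  assumes "v \<in> V - {r}"
  shows "width (dep (par v)) = (2 * M + 4) * width (dep v)"
  using width_Suc[of "par v"] par_in[of v] dep_par[of v] assms by simp

lemma base_step:
  assumes "v \<in> V - {r}"
  shows "base v = base (par v) + slot v * width (dep v)"
proof -
  have "{a \<in> V - {r}. anc a v} = insert v {a \<in> V - {r}. anc a (par v)}"
    using assms anc_iff[of _ v] by auto
  then show ?thesis
    using not_anc_par[OF assms] finite_V by (simp add: base_def)
qed

text \<open>A slot is a valid digit in base \<open>2 * M + 4\<close>, so the stripe of a child fits
  into that of its parent.\<close>

lemma base_nested:
  assumes "anc a v" "v \<in> V"
  shows "base a \<le> base v \<and> base v + width (dep v) \<le> base a + width (dep a)"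
  using assms
proof (induction rule: anc.induct)
  case (anc_step a v)
  show ?case
  proof (cases "v = r")
    case True
    then show ?thesis using anc_step par_root by simp
  next
    case False
    then have v: "v \<in> V - {r}" using anc_step by simp
    have "slot v * width (dep v) + width (dep v) = (slot v + 1) * width (dep v)" by simp
    also have "\<dots> \<le> (2 * M + 4) * width (dep v)"
      using slot_le[OF v] by (intro mult_right_mono) auto
    finally have "base v + width (dep v) \<le> base (par v) + width (dep (par v))"
      using base_step[OF v] width_par[OF v] by simp
    then show ?thesis using anc_step par_in base_step[OF v] by fastforce
  qed
qed simp

text \<open>For \<open>m \<le> M\<close> the own place is a valid digit too, so \<open>w\<close>
  stays in its own stripe and hence in that of each ancestor.\<close>

lemma pos_interval:
  assumes "anc c w" "w \<in> V" "m \<le> M"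
  shows "base c \<le> pos m w" "pos m w < base c + width (dep c)"
proof -
  have "own w m * width (Suc (dep w)) < (2 * M + 4) * width (Suc (dep w))"
    using own_less[OF assms(3), of w] width_pos by (intro mult_strict_right_mono) auto
  then have "pos m w < base w + width (dep w)"
    using width_Suc[OF assms(2)] by (simp add: pos_def)
  then show "base c \<le> pos m w" "pos m w < base c + width (dep c)"
    using base_nested[OF assms(1,2)] by (auto simp: pos_def)
qed

text \<open>The digit at depth \<open>dep c\<close> decides: it is the own place for
  \<open>par c\<close> and the slot of \<open>c\<close> for \<open>w\<close>, and all digits before
  it agree.\<close>

lemma pos_par_less:
  assumes "c \<in> V - {r}" "anc c w" "w \<in> V" "m \<le> M"
  shows "pos m (par c) < pos m w \<longleftrightarrow> own (par c) m < slot c"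
    and "pos m w < pos m (par c) \<longleftrightarrow> slot c < own (par c) m"
proof -
  let ?w = "width (dep c)"
  have p: "pos m (par c) = base (par c) + own (par c) m * ?w"
    using dep_par assms(1) by (simp add: pos_def)
  have w: "base (par c) + slot c * ?w \<le> pos m w" "pos m w < base (par c) + (slot c + 1) * ?w"
    using pos_interval[OF assms(2-)] base_step[OF assms(1)] by auto
  have 1: "pos m (par c) < pos m w" if "own (par c) m < slot c"
  proof -
    have "own (par c) m * ?w < slot c * ?w"
      using that width_pos by (intro mult_strict_right_mono) auto
    then show ?thesis using p w by linarith
  qed
  have 2: "pos m w < pos m (par c)" if "slot c < own (par c) m"
  proof -
    have "(slot c + 1) * ?w \<le> own (par c) m * ?w"
      using that by (intro mult_right_mono) auto
    then show ?thesis using p w by linarith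
  qed
  show "pos m (par c) < pos m w \<longleftrightarrow> own (par c) m < slot c"
    "pos m w < pos m (par c) \<longleftrightarrow> slot c < own (par c) m"
    using 1 2 own_neq_slot[of "par c" m c] by (meson less_asym linorder_neqE_nat)+
qed

text \<open>The deciding digits are slots, which do not depend on time, so vertices below different
  siblings never change order.\<close>

lemma pos_siblings_less:
  assumes "siblings c d" "anc c i" "anc d j" "i \<in> V" "j \<in> V" "m \<le> M"
  shows "pos m i < pos m j \<longleftrightarrow> slot c < slot d"
proof -
  have *: "pos m i < pos m j"
    if cd: "siblings c d" "anc c i" "anc d j" "i \<in> V" "j \<in> V" "slot c < slot d" for c d i j
  proof -
    have c: "c \<in> V - {r}" "d \<in> V - {r}" "par c = par d" using cd by (auto simp: siblings_def)
    have dep: "dep c = dep d" using c dep_par by metis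
    have "pos m i < base c + width (dep c)" using pos_interval cd assms(6) by blast
    also have "\<dots> = base (par c) + (slot c + 1) * width (dep c)" using base_step[OF c(1)] by simp
    also have "\<dots> \<le> base (par c) + slot d * width (dep c)"
      using cd by (intro add_left_mono mult_right_mono) auto
    also have "\<dots> = base d" using base_step[OF c(2)] c dep by simp
    also have "\<dots> \<le> pos m j" using pos_interval cd assms(6) by blast
    finally show ?thesis .
  qed
  show ?thesis
    using *[OF assms(1-5)] *[OF siblings_sym[OF assms(1)] assms(3,2,5,4)] slot_siblings[OF assms(1)]
    by (meson less_asym linorder_neqE_nat)
qed

lemma pos_eq:
  assumes "i \<in> V" "j \<in> V" "m \<le> M" "pos m i = pos m j"
  shows "i = j"
proof (rule ccontr)
  assume "i \<noteq> j"
  with assms(1,2) show False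
  proof (cases rule: positions_cases)
    case (above c)
    then show False
      using pos_par_less[of c j m] own_neq_slot[of i m c] assms by auto
  next
    case (below c)
    then show False
      using pos_par_less[of c i m] own_neq_slot[of j m c] assms by auto
  next
    case (apart c d)
    then show False
      using pos_siblings_less[OF apart assms(1-3)] slot_siblings[OF apart(1)]
        pos_siblings_less[OF siblings_sym[OF apart(1)] apart(3,2) assms(2,1,3)] assms by auto
  qed
qed

section \<open>Characters that meet are neighbours\<close>

lemma own_par_less_slot:
  assumes "meets c m" "m \<le> M"
  shows "own (par c) m < slot c"
  using own_par[OF assms(1)] assms by (auto simp: slot_def meets_def)

text \<open>For light \<open>c\<close> the meeting of \<open>d\<close> ends before that of
  \<open>c\<close> begins, so \<open>par c\<close> has already swept past \<open>d\<close>; for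
  heavy \<open>c\<close> it is past all light stripes.\<close>

lemma slot_less_own:
  assumes "meets c m" "siblings c d" "slot d < slot c"
  shows "slot d < own (par c) m"
proof (cases "light c")
  case True
  then have d: "light d" using assms t_less[of c] by (auto simp: slot_def siblings_def meets_def split: if_splits)
  then have "t d < s c" using assms True siblings_apart[OF assms(2)] s_le_t[of c] s_le_t[of d]
    by (auto simp: slot_def siblings_def)
  then show ?thesis using True d assms own_par[OF assms(1)] by (auto simp: slot_def meets_def)
next
  case False
  then have "light d" using assms(2) by (auto simp: light_def siblings_def)
  then show ?thesis
    using False own_par[OF assms(1)] t_less[of d] assms by (auto simp: slot_def siblings_def)
qed

text \<open>Stripes of siblings with smaller slots lie before \<open>par c\<close>, those with
  larger slots after \<open>c\<close>. A vertex outside the subtree of \<open>par c\<close> has both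
  on one side, since they share a stripe that avoids it.\<close>

lemma meets_adjacent:
  assumes "meets c m" "m \<le> M" "k \<in> V" "k \<noteq> c" "k \<noteq> par c"
  shows "(pos m k < pos m c \<longleftrightarrow> pos m k < pos m (par c)) \<and>
    (pos m c < pos m k \<longleftrightarrow> pos m (par c) < pos m k)"
proof -
  have c: "c \<in> V - {r}" using assms by (simp add: meets_def)
  let ?v = "par c"
  have v: "?v \<in> V" using c par_in by simp
  have less: "pos m ?v < pos m c"
    using pos_par_less(1)[OF c anc_refl] c assms own_par_less_slot by auto
  from v assms(3) assms(5)[symmetric] show ?thesis
  proof (cases rule: positions_cases)
    case (above d)
    show ?thesis
    proof (cases "slot d < slot c")
      case True
      then have "siblings c d" using above c by (auto simp: siblings_def)
      then have "slot d < own ?v m" using slot_less_own assms True by blast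
      then have "pos m k < pos m ?v" using pos_par_less(2)[of d k m] above assms by simp
      then show ?thesis using less by auto
    next
      case False
      have "pos m c \<le> pos m k"
      proof (cases "d = c")
        case True
        \<comment> \<open>While meeting its parent, \<open>c\<close> has own place 0 and so comes
          first in its stripe.\<close>
        have "pos m c = base c" using assms(1) by (simp add: pos_def own_def)
        then show ?thesis using pos_interval[of c k m] True above assms by simp
      next
        case False
        then have sd: "siblings d c" using above c by (auto simp: siblings_def)
        then have "\<not> pos m k < pos m c"
          using pos_siblings_less[OF sd above(3) anc_refl] \<open>\<not> slot d < slot c\<close> c assms by auto
        then show ?thesis by simp
      qed
      moreover have "pos m c \<noteq> pos m k" using pos_eq[of c k m] c assms by auto
      ultimately show ?thesis using less by auto
    qed
  next
    case (below d)
    then have "anc d c" by (auto intro: anc.intros)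
    then show ?thesis
      using pos_par_less[of d c m] pos_par_less[of d ?v m] below c v assms by auto
  next
    case (apart d e)
    have dc: "anc d c" using apart by (auto intro: anc.intros)
    have cV: "c \<in> V" using c by simp
    show ?thesis
      using pos_siblings_less[OF apart(1) dc apart(3) cV assms(3,2)]
        pos_siblings_less[OF apart(1) apart(2,3) v assms(3,2)]
        pos_siblings_less[OF siblings_sym[OF apart(1)] apart(3) dc assms(3) cV assms(2)]
        pos_siblings_less[OF siblings_sym[OF apart(1)] apart(3,2) assms(3) v assms(2)] by blast
  qed
qed

section \<open>Heights with the required distances\<close>

definition height :: "real \<Rightarrow> real \<Rightarrow> nat \<Rightarrow> nat \<Rightarrow> real" where
  "height g D m v = (if meets v m then 2 * D * pos m (par v) + g else 2 * D * pos m v)"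

text \<open>The character whose position determines \<open>height\<close>; a parent and the child it
  meets share their leader.\<close>

definition leader :: "nat \<Rightarrow> nat \<Rightarrow> nat" where
  "leader m v = (if meets v m then par v else v)"

text \<open>Neighbours lie on the same side of any third character, so \<open>i\<close> and
  \<open>j\<close> can be replaced by their leaders one after the other.\<close>

lemma leader_less:
  assumes "m \<le> M" "i \<in> V" "j \<in> V" "i \<noteq> j"
    and ij: "\<not> (meets i m \<and> par i = j)" "\<not> (meets j m \<and> par j = i)"
    and "pos m i < pos m j"
  shows "pos m (leader m i) < pos m (leader m j)"
proof -
  have 1: "pos m (leader m i) < pos m j"
    using meets_adjacent[of i m j] assms by (auto simp: leader_def)
  show ?thesis
  proof (cases "meets j m")
    case True
    have "leader m i \<in> V" "leader m i \<noteq> j" using assms par_in by (auto simp: leader_def)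
    moreover have "leader m i \<noteq> par j"
    \<comment> \<open>Otherwise \<open>i\<close> and \<open>j\<close> would be siblings that both
      meet their parent at time \<open>m\<close>.\<close>
    proof
      assume eq: "leader m i = par j"
      then have "meets i m" using ij True by (auto simp: leader_def split: if_splits)
      then have "siblings i j"
        using eq True assms(4) by (auto simp: leader_def siblings_def meets_def)
      then show False using siblings_not_meet \<open>meets i m\<close> True by blast
    qed
    ultimately show ?thesis
      using meets_adjacent[OF True assms(1), of "leader m i"] 1 True by (auto simp: leader_def[of m j])
  next
    case False
    then show ?thesis using 1 by (simp add: leader_def)
  qed
qed

text \<open>Distinct leader positions give a gap of \<open>2 * D\<close>, of which the shift of a
  grouped child uses at most \<open>g < D\<close>.\<close>

lemma height_separated:
  assumes g: "0 < g" "g < D" and "m \<le> M" "i \<in> V" "j \<in> V" "i \<noteq> j"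
    and "\<not> (meets i m \<and> par i = j)" "\<not> (meets j m \<and> par j = i)" "pos m i < pos m j"
  shows "height g D m i + D \<le> height g D m j"
proof -
  have "pos m (leader m i) + 1 \<le> pos m (leader m j)" using leader_less assms(3-) by fastforce
  then have "real (pos m (leader m i)) + 1 \<le> real (pos m (leader m j))" by linarith
  then have "2 * D * (real (pos m (leader m i)) + 1) \<le> 2 * D * real (pos m (leader m j))"
    using g by (intro mult_left_mono) auto
  moreover have "height g D m i \<le> 2 * D * real (pos m (leader m i)) + g"
    "2 * D * real (pos m (leader m j)) \<le> height g D m j"
    using g by (auto simp: height_def leader_def)
  ultimately show ?thesis using g by (simp add: algebra_simps)
qed

lemma height_child:
  assumes "meets c m"
  shows "height g D m c = height g D m (par c) + g"
  using assms not_meets_par by (simp add: height_def)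

text \<open>The shift keeps the order, because a parent precedes the child it meets in position as
  well as in height.\<close>

lemma height_less:
  assumes g: "0 < g" "g < D" and m: "m \<le> M" and V: "i \<in> V" "j \<in> V" and less: "pos m i < pos m j"
  shows "height g D m i < height g D m j"
proof -
  have par_less: "pos m (par c) < pos m c" if "meets c m" for c
    using pos_par_less(1)[OF _ anc_refl _ m, of c] that own_par_less_slot[OF that m]
    by (auto simp: meets_def)
  consider "meets i m" "par i = j" | "meets j m" "par j = i"
    | "\<not> (meets i m \<and> par i = j)" "\<not> (meets j m \<and> par j = i)" by blast
  then show ?thesis
  proof cases
    case 1
    then show ?thesis using par_less[of i] less by simp
  next
    case 2
    then show ?thesis using height_child[of j m g D] g by simp
  next
    case 3
    then show ?thesis using height_separated[OF g m V _ 3 less] less g by fastforce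
  qed
qed

lemma height_less_iff:
  assumes "0 < g" "g < D" "m \<le> M" "i \<in> V" "j \<in> V"
  shows "height g D m i < height g D m j \<longleftrightarrow> pos m i < pos m j"
  using height_less[OF assms] height_less[OF assms(1-3,5,4)] pos_eq[OF assms(4,5,3)]
  by (metis less_asym less_irrefl linorder_neqE_nat)

section \<open>Counting the changes of order\<close>

definition change_times :: "nat \<Rightarrow> nat set" where
  "change_times c = set [t c, s (par c) - 1, t (par c),
     s (heavy_child (par c)) - 1, t (heavy_child (par c))]"

text \<open>The sweep \<open>2 * m\<close> passes the slot \<open>2 * t c + 1\<close> right after
  time \<open>t c\<close>. It is interrupted only by the meetings of \<open>par c\<close> with its
  parent and its heavy child, each giving the last time before its start and its end. A meeting that
  starts at 0 has no change at its start, so truncated subtraction is harmless.\<close>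

lemma own_change:
  assumes "light c" "(own (par c) m < slot c) \<noteq> (own (par c) (Suc m) < slot c)"
  shows "m \<in> change_times c"
proof (rule ccontr)
  assume no: "m \<notin> change_times c"
  have 1: "meets (par c) m \<longleftrightarrow> meets (par c) (Suc m)"
    using no by (auto simp: meets_def change_times_def)
  have 2: "meets_heavy (par c) m \<longleftrightarrow> meets_heavy (par c) (Suc m)"
    using no by (auto simp: meets_heavy_def meets_def change_times_def)
  show False
    using assms 1 2 no by (auto simp: own_def slot_def change_times_def)
qed

text \<open>Only an ancestor and a descendant can change order; \<open>c\<close> is the child of the
  ancestor towards the descendant.\<close>

lemma pos_change:
  assumes "i \<in> V" "j \<in> V" "i \<noteq> j" "m < M"
    and change: "(pos m i < pos m j) \<noteq> (pos (Suc m) i < pos (Suc m) j)"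
  shows "(\<exists>c \<in> light_above j. par c = i \<and> m \<in> change_times c) \<or>
    (\<exists>c \<in> light_above i. par c = j \<and> m \<in> change_times c)"
proof -
  have m: "m \<le> M" "Suc m \<le> M" using assms by auto
  \<comment> \<open>The own place never reaches the heavy slot \<open>2 * M + 3\<close>, so no
    vertex passes the stripe of its heavy child.\<close>
  have lt: "light c" if "c \<in> V - {r}" "(own (par c) m < slot c) \<noteq> (own (par c) (Suc m) < slot c)" for c
  proof (rule ccontr)
    assume "\<not> light c"
    then show False using own_less[OF m(1), of "par c"] own_less[OF m(2), of "par c"] that
      by (auto simp: slot_def)
  qed
  from assms(1-3) show ?thesis
  proof (cases rule: positions_cases)
    case (above c)
    have ch: "(own (par c) m < slot c) \<noteq> (own (par c) (Suc m) < slot c)"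
      using change pos_par_less(1)[OF above(1,3) assms(2) m(1)]
        pos_par_less(1)[OF above(1,3) assms(2) m(2)] above by blast
    have "light c" using lt[OF above(1) ch] .
    then show ?thesis using own_change[OF _ ch] above by (auto simp: light_above_def)
  next
    case (below c)
    have ch: "(own (par c) m < slot c) \<noteq> (own (par c) (Suc m) < slot c)"
      using change pos_par_less(2)[OF below(1,3) assms(1) m(1)]
        pos_par_less(2)[OF below(1,3) assms(1) m(2)] below own_neq_slot[of "par c" _ c]
      by (metis less_asym linorder_neqE_nat)
    have "light c" using lt[OF below(1) ch] .
    then show ?thesis using own_change[OF _ ch] below by (auto simp: light_above_def)
  next
    case (apart c d)
    then show ?thesis
      using change pos_siblings_less[OF apart assms(1,2) m(1)] pos_siblings_less[OF apart assms(1,2) m(2)]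
      by blast
  qed
qed

text \<open>A change is charged to the descendant \<open>w\<close>, the light \<open>c\<close> above
  or equal to \<open>w\<close> whose parent is the other character, and the time. Each
  \<open>w\<close> has at most \<open>log 2 (card V)\<close> such \<open>c\<close>, each with at
  most five times.\<close>

lemma card_changes:
  "real (card {(i, j, m). i \<in> V \<and> j \<in> V \<and> i < j \<and> m < M \<and>
      (pos m i < pos m j) \<noteq> (pos (Suc m) i < pos (Suc m) j)})
    \<le> 5 * real (card V) * log 2 (real (card V))" (is "real (card ?S) \<le> _")
proof -
  let ?Q = "SIGMA w:V. SIGMA c:light_above w. change_times c"
  \<comment> \<open>The charge follows the ancestor relation while \<open>?S\<close> lists the
    smaller number first, hence \<open>min\<close> and \<open>max\<close>.\<close>
  let ?f = "\<lambda>(w, c, m). (min (par c) w, max (par c) w, m)"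
  have fin: "finite (SIGMA c:light_above w. change_times c)" for w
    using finite_light_above by (auto simp: change_times_def)
  then have "finite ?Q" using finite_V by blast
  have "?S \<subseteq> ?f ` ?Q"
  proof
    fix x assume "x \<in> ?S"
    then obtain i j m where x: "x = (i, j, m)" and ij: "i \<in> V" "j \<in> V" "i < j" "m < M"
      and ch: "(pos m i < pos m j) \<noteq> (pos (Suc m) i < pos (Suc m) j)" by blast
    from pos_change[OF ij(1,2) _ ij(4) ch] ij(3)
    consider c where "c \<in> light_above j" "par c = i" "m \<in> change_times c"
      | c where "c \<in> light_above i" "par c = j" "m \<in> change_times c" by auto
    then show "x \<in> ?f ` ?Q"
    proof cases
      case 1
      then show ?thesis using ij x by (intro image_eqI[of _ _ "(j, c, m)"]) auto
    next
      case 2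
      then show ?thesis using ij x by (intro image_eqI[of _ _ "(i, c, m)"]) auto
    qed
  qed
  then have "card ?S \<le> card ?Q" using \<open>finite ?Q\<close> by (rule surj_card_le[rotated])
  also have "\<dots> = (\<Sum>w\<in>V. \<Sum>c\<in>light_above w. card (change_times c))"
    using finite_V fin finite_light_above by (simp add: card_SigmaI change_times_def)
  also have "\<dots> \<le> (\<Sum>w\<in>V. \<Sum>c\<in>light_above w. 5)"
  proof (intro sum_mono)
    show "card (change_times c) \<le> 5" for c
      unfolding change_times_def by (rule order_trans[OF card_length]) simp
  qed
  finally have "real (card ?S) \<le> real (\<Sum>w\<in>V. \<Sum>c\<in>light_above w. 5)" by linarith
  also have "\<dots> = (\<Sum>w\<in>V. 5 * real (card (light_above w)))" by (simp add: mult.commute)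
  also have "\<dots> \<le> (\<Sum>w\<in>V. 5 * log 2 (real (card V)))"
    using light_above_card by (intro sum_mono mult_left_mono) auto
  also have "\<dots> = 5 * real (card V) * log 2 (real (card V))" by simp
  finally show ?thesis .
qed

lemma card_height_changes:
  assumes "0 < g" "g < D"
  shows "real (card {(i, j, m). i \<in> V \<and> j \<in> V \<and> i < j \<and> m < M \<and>
      (height g D m i < height g D m j) \<noteq> (height g D (Suc m) i < height g D (Suc m) j)})
    \<le> 5 * real (card V) * log 2 (real (card V))"
proof -
  have "{(i, j, m). i \<in> V \<and> j \<in> V \<and> i < j \<and> m < M \<and>
      (height g D m i < height g D m j) \<noteq> (height g D (Suc m) i < height g D (Suc m) j)} =
    {(i, j, m). i \<in> V \<and> j \<in> V \<and> i < j \<and> m < M \<and>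
      (pos m i < pos m j) \<noteq> (pos (Suc m) i < pos (Suc m) j)}"
    using height_less_iff[OF assms] by fastforce
  then show ?thesis using card_changes by simp
qed

lemma inj_on_height:
  assumes "0 < g" "g < D" "m \<le> M"
  shows "inj_on (height g D m) V"
proof (rule inj_onI)
  fix i j assume ij: "i \<in> V" "j \<in> V" "height g D m i = height g D m j"
  then have "pos m i = pos m j"
    using height_less_iff[OF assms ij(1,2)] height_less_iff[OF assms ij(2,1)] by auto
  then show "i = j" using pos_eq ij assms by blast
qed

lemma height_far:
  assumes "0 < g" "g < D" "m \<le> M" "i \<in> V" "j \<in> V" "i \<noteq> j"
    and "\<not> (meets i m \<and> par i = j)" "\<not> (meets j m \<and> par j = i)"
  shows "D \<le> \<bar>height g D m i - height g D m j\<bar>"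
proof (cases "pos m i < pos m j")
  case True
  then show ?thesis using height_separated[OF assms] by linarith
next
  case False
  then have "pos m j < pos m i" using pos_eq assms by (meson linorder_neqE_nat)
  then show ?thesis
    using height_separated[OF assms(1-3,5,4) assms(6)[symmetric] assms(8,7)] by linarith
qed

end

section \<open>Rooting an acyclic connected graph\<close>

lemma graph_cycleI:
  assumes "3 \<le> length xs" "distinct xs" "successively (\<lambda>x y. {x, y} \<in> F) xs" "{last xs, hd xs} \<in> F"
  shows "graph_cycle F xs"
  unfolding graph_cycle_def
proof (intro conjI allI impI)
  fix i assume i: "i < length xs"
  have ne: "xs \<noteq> []" using assms(1) by auto
  show "{xs ! i, xs ! (Suc i mod length xs)} \<in> F"
  proof (cases "Suc i < length xs")
    case True
    then show ?thesis using assms(3) by (simp add: successively_conv_nth)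
  next
    case False
    then have "length xs = Suc i" using i by simp
    then show ?thesis using assms(4) ne by (simp add: last_conv_nth hd_conv_nth)
  qed
qed (use assms in auto)

context rooted_tree
begin

text \<open>That the path stays between \<open>a\<close> and \<open>v\<close> serves to show that it
  avoids \<open>par a\<close> and paths below a sibling of \<open>a\<close>.\<close>

lemma upward_path:
  assumes "anc a v" "v \<in> V" and F: "\<And>w. w \<in> V - {r} \<Longrightarrow> {w, par w} \<in> F"
  shows "\<exists>xs. xs \<noteq> [] \<and> hd xs = v \<and> last xs = a \<and> distinct xs \<and>
    successively (\<lambda>x y. {x, y} \<in> F) xs \<and> (\<forall>x \<in> set xs. x \<in> V \<and> anc a x \<and> anc x v)"
  using assms(1,2)
proof (induction rule: anc.induct)
  case (anc_refl v)
  then show ?case by (intro exI[of _ "[v]"]) (auto intro: anc.intros)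
next
  case (anc_step a v)
  then obtain xs where xs: "xs \<noteq> []" "hd xs = par v" "last xs = a" "distinct xs"
    "successively (\<lambda>x y. {x, y} \<in> F) xs" "\<forall>x \<in> set xs. x \<in> V \<and> anc a x \<and> anc x (par v)"
    using par_in by blast
  show ?case
  proof (cases "v = r")
    case True
    then show ?thesis using xs par_root by (intro exI[of _ xs]) auto
  next
    case False
    then have v: "v \<in> V - {r}" using anc_step by simp
    then have "v \<notin> set xs" using xs(6) not_anc_par by blast
    moreover have "anc a v" using anc_step.hyps by (rule anc.anc_step)
    ultimately show ?thesis
      using xs F[OF v] v by (intro exI[of _ "v # xs"])
        (auto simp: successively_Cons intro: anc.intros)
  qed
qed

text \<open>The edge closes the path from \<open>v\<close> up to \<open>c\<close> and on to
  \<open>par c\<close>; \<open>c \<noteq> v\<close> gives it three vertices.\<close>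

lemma cycle_from_ancestor_edge:
  assumes F: "\<And>w. w \<in> V - {r} \<Longrightarrow> {w, par w} \<in> F"
    and "{par c, v} \<in> F" "c \<in> V - {r}" "anc c v" "v \<in> V" "c \<noteq> v"
  shows "\<exists>xs. graph_cycle F xs"
proof -
  obtain xs where xs: "xs \<noteq> []" "hd xs = v" "last xs = c" "distinct xs"
    "successively (\<lambda>x y. {x, y} \<in> F) xs" "\<forall>x \<in> set xs. x \<in> V \<and> anc c x \<and> anc x v"
    using upward_path[OF assms(4,5) F] by blast
  have "par c \<notin> set xs" using xs(6) not_anc_par[OF assms(3)] by blast
  moreover have "2 \<le> length xs"
    using xs(1-3) assms(6) by (cases xs; cases "tl xs") auto
  ultimately have "graph_cycle F (xs @ [par c])"
    using xs F[OF assms(3)] assms(2)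
    by (intro graph_cycleI) (auto simp: successively_append_iff)
  then show ?thesis ..
qed

text \<open>The paths from \<open>u\<close> up to \<open>c\<close> and from \<open>v\<close> up to
  \<open>d\<close> lie in disjoint subtrees; \<open>par c\<close> joins them and the edge closes the
  cycle.\<close>

lemma cycle_from_siblings_edge:
  assumes F: "\<And>w. w \<in> V - {r} \<Longrightarrow> {w, par w} \<in> F"
    and "{u, v} \<in> F" "siblings c d" "anc c u" "anc d v" "u \<in> V" "v \<in> V"
  shows "\<exists>xs. graph_cycle F xs"
proof -
  have cd: "c \<in> V - {r}" "d \<in> V - {r}" "par c = par d" using assms(3) by (auto simp: siblings_def)
  obtain xs where xs: "xs \<noteq> []" "hd xs = u" "last xs = c" "distinct xs"
    "successively (\<lambda>x y. {x, y} \<in> F) xs" "\<forall>x \<in> set xs. x \<in> V \<and> anc c x \<and> anc x u"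
    using upward_path[OF assms(4,6) F] by blast
  obtain ys where ys: "ys \<noteq> []" "hd ys = v" "last ys = d" "distinct ys"
    "successively (\<lambda>x y. {x, y} \<in> F) ys" "\<forall>x \<in> set ys. x \<in> V \<and> anc d x \<and> anc x v"
    using upward_path[OF assms(5,7) F] by blast
  have len: "1 \<le> length xs" "1 \<le> length ys" using xs(1) ys(1) by (auto simp: Suc_le_eq)
  have "par c \<notin> set xs" "par c \<notin> set ys"
    using xs(6) ys(6) not_anc_par[OF cd(1)] not_anc_par[OF cd(2)] cd(3) by auto
  moreover have "set xs \<inter> set ys = {}"
    using xs(6) ys(6) siblings_subtree_disjoint[OF assms(3)] by (auto simp: subtree_def)
  moreover have "successively (\<lambda>x y. {x, y} \<in> F) (rev ys)"
    using ys(5) by (simp add: insert_commute)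
  ultimately have "graph_cycle F (xs @ par c # rev ys)"
    using xs ys len F[OF cd(1)] F[OF cd(2)] cd(3) assms(2)
    by (intro graph_cycleI)
      (auto simp: successively_append_iff successively_Cons hd_rev last_rev insert_commute)
  then show ?thesis ..
qed

lemma tree_edge_cases:
  assumes "\<And>w. w \<in> V - {r} \<Longrightarrow> {w, par w} \<in> F" "\<nexists>xs. graph_cycle F xs"
    and "{u, v} \<in> F" "u \<in> V" "v \<in> V" "u \<noteq> v"
  shows "(u \<in> V - {r} \<and> par u = v) \<or> (v \<in> V - {r} \<and> par v = u)"
  using assms(4-6)
proof (cases rule: positions_cases)
  case (above c)
  then show ?thesis using cycle_from_ancestor_edge[of F c v] assms by auto
next
  case (below c)
  then show ?thesis
    using cycle_from_ancestor_edge[of F c u] assms by (auto simp: insert_commute)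
next
  case (apart c d)
  then show ?thesis using cycle_from_siblings_edge[of F u v c d] assms by blast
qed

end

text \<open>Breadth-first search: \<open>dep\<close> is the distance from \<open>r\<close>, and a
  parent is the last vertex before \<open>v\<close> on a shortest walk.\<close>

lemma connected_rooted_tree:
  fixes V :: "nat set"
  assumes "finite V" "r \<in> V" "graph_connected V F" and F: "\<And>u v. {u, v} \<in> F \<Longrightarrow> u \<in> V"
  obtains par dep where "rooted_tree V r par dep" "\<And>v. v \<in> V - {r} \<Longrightarrow> {v, par v} \<in> F"
proof -
  define R where "R = {(x, y). {x, y} \<in> F}"
  define dep where "dep v = (LEAST k. (r, v) \<in> R ^^ k)" for v
  have reach: "(r, v) \<in> R ^^ dep v" if v: "v \<in> V" for v
  proof -
    have "(r, v) \<in> R\<^sup>*" using assms(2,3) v by (auto simp: graph_connected_def R_def)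
    then obtain k where "(r, v) \<in> R ^^ k" by (auto simp: rtrancl_power)
    then show ?thesis unfolding dep_def by (rule LeastI)
  qed
  have dep_le: "dep v \<le> k" if "(r, v) \<in> R ^^ k" for v k
    using that unfolding dep_def by (rule Least_le)
  have dep_r: "dep r = 0" using dep_le[of r 0] by simp
  have "\<exists>w. {v, w} \<in> F \<and> dep v = Suc (dep w)" if v: "v \<in> V - {r}" for v
  proof -
    have "dep v \<noteq> 0" using reach[of v] v by (cases "dep v") auto
    then obtain k where k: "dep v = Suc k" by (cases "dep v") auto
    then obtain w where w: "(r, w) \<in> R ^^ k" "(w, v) \<in> R" using reach[of v] v by auto
    have wF: "{w, v} \<in> F" using w by (simp add: R_def)
    \<comment> \<open>A smaller distance of \<open>w\<close> would give a walk to \<open>v\<close>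
      shorter than \<open>dep v\<close>.\<close>
    have "(r, v) \<in> R ^^ Suc (dep w)" using reach[of w] w F[OF wF] by auto
    then have "dep v \<le> Suc (dep w)" by (rule dep_le)
    then have "dep w = k" using dep_le[OF w(1)] k by simp
    then show ?thesis using k wF by (auto simp: insert_commute)
  qed
  then obtain p where p: "\<And>v. v \<in> V - {r} \<Longrightarrow> {v, p v} \<in> F \<and> dep v = Suc (dep (p v))" by metis
  have "p v \<in> V" if "v \<in> V - {r}" for v
    using F[of "p v" v] p[OF that] by (simp add: insert_commute)
  then have "rooted_tree V r (p(r := r)) dep"
    using assms(1,2) dep_r p by unfold_locales auto
  then show thesis using p by (intro that[of "p(r := r)" dep]) auto
qed

section \<open>The bound for storylines whose event graph is a tree\<close>

theorem theorem1:
  "\<exists>c::real. c > 0 \<and>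
     (\<forall>(d_group::real) (d_separate::real) (n::nat) (T::interval set) (E::event set).
        0 < d_group \<longrightarrow> d_group < d_separate \<longrightarrow> n \<ge> 2 \<longrightarrow>
        storyline n T E \<longrightarrow> pairwise_single_meeting E \<longrightarrow>
        graph_tree {1..n} (event_graph_edges E) \<longrightarrow>
        (\<exists>y. storyline_visualization d_group d_separate n E y \<and>
             real (num_crossings n y) \<le> c * real n * log 2 (real n)))"
proof (rule exI[of _ 5], intro conjI allI impI)
  fix g D :: real and n :: nat and T :: "interval set" and E :: "event set"
  assume g: "0 < g" "g < D" and n: "2 \<le> n" and st: "storyline n T E"
    and single: "pairwise_single_meeting E" and tree: "graph_tree {1..n} (event_graph_edges E)"
  define V where "V = {1..n}"
  define r where "r = (1::nat)"
  let ?F = "event_graph_edges E"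
  have sub: "A \<subseteq> V" if "(A, I) \<in> E" for A I
    using st that by (auto simp: storyline_def V_def)
  have le: "s \<le> t" if "(A, (s, t)) \<in> E" for A s t
    using st that by (auto simp: storyline_def)
  have two: "u \<noteq> v" if "({u, v}, I) \<in> E" for u v I
    using single that by (force simp: pairwise_single_meeting_def)
  have pair: "\<exists>u v. e = ({u, v}, snd e)" if "e \<in> E" for e
  proof -
    have "card (fst e) = 2" using single that by (simp add: pairwise_single_meeting_def)
    then show ?thesis by (cases e) (auto simp: card_2_iff)
  qed
  have uniq: "e = e'" if e: "e \<in> E" "e' \<in> E" "fst e = fst e'" for e e'
  proof -
    obtain u v where uv: "e = ({u, v}, snd e)" using pair[OF e(1)] by blast
    then have "u \<noteq> v" "fst e = {u, v}" using two e(1) by (metis, metis fst_conv)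
    then show ?thesis using single e unfolding pairwise_single_meeting_def by (metis order_refl)
  qed
  have edge: "{u, v} \<in> ?F \<longleftrightarrow> (\<exists>s t. ({u, v}, (s, t)) \<in> E)" for u v
    unfolding event_graph_edges_def mem_Collect_eq by metis
  \<comment> \<open>An event is determined by its pair of characters, so there are finitely many
    events and their end times have a common bound.\<close>
  have "finite E"
  proof (rule inj_on_finite[of fst _ "Pow V"])
    show "inj_on fst E" using uniq by (auto intro: inj_onI)
    show "fst ` E \<subseteq> Pow V" using sub by force
  qed (simp add: V_def)
  then have "finite ((\<lambda>e. snd (snd e)) ` E)" by simp
  then obtain M where M: "\<And>A s t. (A, (s, t)) \<in> E \<Longrightarrow> t < M"
    unfolding finite_nat_set_iff_bounded by force
  obtain par dep where "rooted_tree V r par dep"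
    and par_edge: "\<And>v. v \<in> V - {r} \<Longrightarrow> {v, par v} \<in> ?F"
  proof (rule connected_rooted_tree[of V r ?F])
    show "u \<in> V" if "{u, v} \<in> ?F" for u v using that sub unfolding edge by blast
  qed (use n tree in \<open>auto simp: graph_tree_def V_def r_def\<close>)
  then interpret rooted_tree V r par dep by simp
  obtain s t where ev: "\<And>v. v \<in> V - {r} \<Longrightarrow> ({v, par v}, (s v, t v)) \<in> E"
    using par_edge unfolding edge by metis
  have apart: "t c < s d \<or> t d < s c"
    if "c \<in> V - {r}" "d \<in> V - {r}" "{c, par c} \<noteq> {d, par d}" "{c, par c} \<inter> {d, par d} \<noteq> {}" for c d
  proof (rule ccontr)
    assume "\<not> ?thesis"
    \<comment> \<open>If neither meeting ends before the other starts, the later start belongs to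
      both.\<close>
    then have "max (s c) (s d) \<in> {s c..t c} \<inter> {s d..t d}"
      using le[OF ev[OF that(1)]] le[OF ev[OF that(2)]] by auto
    then have "overlap (s c, t c) (s d, t d)" unfolding overlap_def by auto
    then show False
      using storyline_disjoint[OF st ev[OF that(1)] ev[OF that(2)]] that(3,4) by auto
  qed
  interpret tree_schedule V r par dep s t M
  proof
    fix v assume "v \<in> V - {r}"
    then show "t v < M" "s v \<le> t v" using ev M le by blast+
  next
    fix c d assume cd: "siblings c d"
    then have "{c, par c} \<noteq> {d, par d}"
      using dep_par[of c] by (auto simp: siblings_def doubleton_eq_iff)
    then show "t c < s d \<or> t d < s c" using apart[of c d] cd by (auto simp: siblings_def)
  next
    fix c assume c: "c \<in> V - {r}" "par c \<in> V - {r}"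
    have "{c, par c} \<noteq> {par c, par (par c)}"
      using dep_par[OF c(1)] dep_par[OF c(2)] by (auto simp: doubleton_eq_iff)
    then show "t c < s (par c) \<or> t (par c) < s c" using apart[OF c] by auto
  qed
  have close: "\<bar>height g D m i - height g D m j\<bar> \<le> g"
    if A: "(A, (s', t')) \<in> E" "s' \<le> m" "m \<le> t'" "i \<in> A" "j \<in> A" for m A s' t' i j
  proof (cases "i = j")
    case False
    obtain u v where "A = {u, v}" using pair[OF A(1)] by auto
    then have A_eq: "A = {i, j}" using A(4,5) False by auto
    then have "{i, j} \<in> ?F" "i \<in> V" "j \<in> V" using A(1) edge sub by blast+
    \<comment> \<open>Acyclicity makes every event a meeting of parent and child, and its pair then
      determines its interval.\<close>
    then have "(i \<in> V - {r} \<and> par i = j) \<or> (j \<in> V - {r} \<and> par j = i)"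
      using tree_edge_cases[of ?F i j] par_edge tree False by (auto simp: graph_tree_def)
    moreover have "meets c m" if "c \<in> V - {r}" "A = {c, par c}" for c
    proof -
      have "s' = s c" "t' = t c" using uniq[OF A(1) ev[OF that(1)]] that(2) by auto
      then show ?thesis using that A by (simp add: meets_def)
    qed
    ultimately have "(meets i m \<and> par i = j) \<or> (meets j m \<and> par j = i)"
      using A_eq by (metis insert_commute)
    then show ?thesis using height_child[of i m g D] height_child[of j m g D] g by auto
  qed (use g in simp)
  have far: "D \<le> \<bar>height g D m i - height g D m j\<bar>"
    if "m \<le> M" "i \<in> V" "j \<in> V" "i \<noteq> j"
      and no: "\<nexists>A s t. (A, (s, t)) \<in> E \<and> {i, j} \<subseteq> A \<and> s \<le> m \<and> m \<le> t" for m i j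
  proof -
    have "\<exists>A s t. (A, (s, t)) \<in> E \<and> {c, par c} \<subseteq> A \<and> s \<le> m \<and> m \<le> t" if "meets c m" for c
      using that ev[of c] unfolding meets_def by blast
    then have "\<not> (meets i m \<and> par i = j)" "\<not> (meets j m \<and> par j = i)"
      using no by (metis, metis insert_commute)
    then show ?thesis using height_far[OF g that(1-4)] by simp
  qed
  have "\<exists>y. storyline_visualization g D n E y \<and>
    num_crossings n y \<le> card {(i, j, m). i \<in> V \<and> j \<in> V \<and> i < j \<and> m < M \<and>
      (height g D m i < height g D m j) \<noteq> (height g D (Suc m) i < height g D (Suc m) j)}"
    by (rule visualization_from_heights[where n = n, folded V_def, OF g st])
      (fact M inj_on_height[OF g] close far)+
  then obtain y where y: "storyline_visualization g D n E y"
    "num_crossings n y \<le> card {(i, j, m). i \<in> V \<and> j \<in> V \<and> i < j \<and> m < M \<and>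
      (height g D m i < height g D m j) \<noteq> (height g D (Suc m) i < height g D (Suc m) j)}"
    by blast
  have "real (num_crossings n y) \<le> 5 * real n * log 2 (real n)"
    using y(2) card_height_changes[OF g] by (simp add: V_def)
  with y(1) show "\<exists>y. storyline_visualization g D n E y \<and>
      real (num_crossings n y) \<le> 5 * real n * log 2 (real n)" by blast
qed simp

end
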